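(* For any compact space $K$ the following conditions are equivalent: (i) $K$ is Eberlein compact; (ii) the Alexandroff duplicate $AD(K)$ is Eberlein compact; (iii) the Alexandroff duplicate $AD(K)$ is semi-Eberlein compact.
   Context: All spaces are assumed to be Tychonoff; in particular compact spaces are Hausdorff. The Alexandroff duplicate $AD(X)$ of a space $X$ is the set $X\times\{0,1\}$ with the following topology: points of $X\times\{1\}$ are isolated, and a basic open neighborhood of $(x,0)$ is of the form $(U\times\{0,1\})\setminus\{(x,1)\}$, where $U$ is an open neighborhood of $x$ in $X$. For a set $\Gamma$ let $c_0(\Gamma)=\{x\in[0,1]^\Gamma:\forall\varepsilon>0\ \{\gamma\in\Gamma:x(\gamma)>\varepsilon\}\text{ is finite}\}$. A compact space is Eberlein compact if it is homeomorphic to a weakly compact subset of a Banach space; equivalently, for some set $\Gamma$, it is homeomorphic to a compact subset of $c_0(\Gamma)$ (with the topology inherited from the product $[0,1]^\Gamma$). A compact space $K$ is semi-Eberlein if, for some set $\Gamma$, there is a homeomorphic embedding $h:K\to[0,1]^\Gamma$ such that $c_0(\Gamma)\cap h(K)$ is dense in $h(K)$. *)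

theory Defs
  imports "HOL-Analysis.Analysis"
begin

text \<open>
  Following the convention that all spaces are Tychonoff, ``compact'' always means
  compact and Hausdorff.
\<close>

text \<open>
  The levels \<open>0\<close> and \<open>1\<close> of the Alexandroff duplicate are \<open>False\<close> and \<open>True\<close>. Points of
  level \<open>True\<close> are isolated, so openness imposes no condition at them.
\<close>

definition alexandroff_duplicate :: "'a topology \<Rightarrow> ('a \<times> bool) topology" where
  "alexandroff_duplicate X = topology (\<lambda>W. W \<subseteq> topspace X \<times> UNIV \<and>
     (\<forall>x. (x, False) \<in> W \<longrightarrow>
        (\<exists>U. openin X U \<and> x \<in> U \<and> (U \<times> UNIV) - {(x, True)} \<subseteq> W)))"

lemma openin_alexandroff_duplicate:
  "openin (alexandroff_duplicate X) W \<longleftrightarrow> W \<subseteq> topspace X \<times> UNIV \<and>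
     (\<forall>x. (x, False) \<in> W \<longrightarrow>
        (\<exists>U. openin X U \<and> x \<in> U \<and> (U \<times> UNIV) - {(x, True)} \<subseteq> W))"
proof -
  let ?L = "\<lambda>W. W \<subseteq> topspace X \<times> UNIV \<and>
     (\<forall>x. (x, False) \<in> W \<longrightarrow>
        (\<exists>U. openin X U \<and> x \<in> U \<and> (U \<times> UNIV) - {(x, True)} \<subseteq> W))"
  have "istopology ?L"
    unfolding istopology_def
  proof (intro conjI allI impI)
    fix S T assume S: "?L S" and T: "?L T"
    show "S \<inter> T \<subseteq> topspace X \<times> UNIV" using S by blast
    fix x assume x: "(x, False) \<in> S \<inter> T"
    obtain U where U: "openin X U" "x \<in> U" "(U \<times> UNIV) - {(x, True)} \<subseteq> S"
      using S x by blast
    obtain V where V: "openin X V" "x \<in> V" "(V \<times> UNIV) - {(x, True)} \<subseteq> T"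
      using T x by blast
    show "\<exists>U. openin X U \<and> x \<in> U \<and> (U \<times> UNIV) - {(x, True)} \<subseteq> S \<inter> T"
      using U V by (intro exI[of _ "U \<inter> V"]) blast
  next
    fix \<K> assume K: "\<forall>W\<in>\<K>. ?L W"
    show "\<Union>\<K> \<subseteq> topspace X \<times> UNIV"
    proof (rule Union_least)
      fix W assume "W \<in> \<K>"
      with K show "W \<subseteq> topspace X \<times> UNIV" by (auto dest: bspec)
    qed
    fix x assume "(x, False) \<in> \<Union>\<K>"
    then obtain W where W: "W \<in> \<K>" "(x, False) \<in> W" by (rule UnionE)
    from bspec[OF K W(1)] W(2) obtain U where
      U: "openin X U" "x \<in> U" "(U \<times> UNIV) - {(x, True)} \<subseteq> W"
      by metis
    from U(3) have "(U \<times> UNIV) - {(x, True)} \<subseteq> \<Union>\<K>"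
      using W(1) by (rule order_trans[OF _ Union_upper])
    then show "\<exists>U. openin X U \<and> x \<in> U \<and> (U \<times> UNIV) - {(x, True)} \<subseteq> \<Union>\<K>"
      using U(1,2) by (intro exI[of _ U] conjI)
  qed
  then show ?thesis
    unfolding alexandroff_duplicate_def by (simp add: topology_inverse')
qed

lemma topspace_alexandroff_duplicate [simp]:
  "topspace (alexandroff_duplicate X) = topspace X \<times> UNIV"
proof
  show "topspace (alexandroff_duplicate X) \<subseteq> topspace X \<times> UNIV"
    using openin_topspace[of "alexandroff_duplicate X"]
    unfolding openin_alexandroff_duplicate by blast
  have "openin (alexandroff_duplicate X) (topspace X \<times> UNIV)"
    unfolding openin_alexandroff_duplicate using openin_topspace[of X] by blast
  then show "topspace X \<times> UNIV \<subseteq> topspace (alexandroff_duplicate X)"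
    by (rule openin_subset)
qed

definition unit_cube :: "'g set \<Rightarrow> ('g \<Rightarrow> real) topology" where
  "unit_cube \<Gamma> = product_topology (\<lambda>_. top_of_set {0..1}) \<Gamma>"

definition c_0 :: "'g set \<Rightarrow> ('g \<Rightarrow> real) set" where
  "c_0 \<Gamma> = {x \<in> \<Gamma> \<rightarrow>\<^sub>E {0..1}. \<forall>\<epsilon>>0. finite {\<gamma> \<in> \<Gamma>. x \<gamma> > \<epsilon>}}"

text \<open>
  HOL cannot quantify over the type of the index set \<open>\<Gamma>\<close>, so the definitions below let
  \<open>\<Gamma>\<close> range over the subsets of one type depending on the space, namely
  \<open>'a \<Rightarrow> real\<close>. This is no restriction: the lemmas \<open>eberlein_compactI\<close> and
  \<open>semi_eberlein_compactI\<close> show that an index set of any other type may be used instead.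
\<close>

definition eberlein_compact :: "'a topology \<Rightarrow> bool" where
  "eberlein_compact X \<longleftrightarrow> compact_space X \<and> Hausdorff_space X \<and>
     (\<exists>(\<Gamma> :: ('a \<Rightarrow> real) set) C. C \<subseteq> c_0 \<Gamma> \<and> compactin (unit_cube \<Gamma>) C \<and>
        X homeomorphic_space subtopology (unit_cube \<Gamma>) C)"

definition semi_eberlein_compact :: "'a topology \<Rightarrow> bool" where
  "semi_eberlein_compact X \<longleftrightarrow> compact_space X \<and> Hausdorff_space X \<and>
     (\<exists>(\<Gamma> :: ('a \<Rightarrow> real) set) h. embedding_map X (unit_cube \<Gamma>) h \<and>
        subtopology (unit_cube \<Gamma>) (h ` topspace X) closure_of (c_0 \<Gamma> \<inter> h ` topspace X)
          = h ` topspace X)"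

lemma topspace_unit_cube [simp]: "topspace (unit_cube \<Gamma>) = \<Gamma> \<rightarrow>\<^sub>E {0..1}"
  by (simp add: unit_cube_def)

lemma Hausdorff_space_unit_cube: "Hausdorff_space (unit_cube \<Gamma>)"
  by (simp add: unit_cube_def Hausdorff_space_product_topology Hausdorff_space_subtopology)

text \<open>
  Reindexing by the coordinate functions themselves, i.e. replacing each index \<open>\<gamma>\<close> by
  the function \<open>\<lambda>x. h x \<gamma>\<close>.
\<close>

lemma unit_cube_reindex:
  fixes X :: "'a topology" and \<Gamma> :: "'g set"
  assumes X: "compact_space X" and h: "embedding_map X (unit_cube \<Gamma>) h"
  obtains \<Delta> :: "('a \<Rightarrow> real) set" and k
  where "embedding_map X (unit_cube \<Delta>) k"
    and "\<And>x. x \<in> topspace X \<Longrightarrow> h x \<in> c_0 \<Gamma> \<Longrightarrow> k x \<in> c_0 \<Delta>"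
proof
  let ?\<Delta> = "(\<lambda>\<gamma> x. h x \<gamma>) ` \<Gamma>"
  let ?k = "\<lambda>x. \<lambda>f\<in>?\<Delta>. f x"
  have hom: "homeomorphic_map X (subtopology (unit_cube \<Gamma>) (h ` topspace X)) h"
    using h by (simp add: embedding_map_def)
  then have cont: "continuous_map X (unit_cube \<Gamma>) h"
    using homeomorphic_imp_continuous_map continuous_map_in_subtopology by blast
  have inj: "inj_on h (topspace X)"
    using hom by (simp add: homeomorphic_eq_everything_map)
  have hx: "h x \<in> \<Gamma> \<rightarrow>\<^sub>E {0..1}" if "x \<in> topspace X" for x
    using continuous_map_funspace[OF cont] that by auto
  have coord: "continuous_map X (top_of_set {0..1}) (\<lambda>x. h x \<gamma>)" if "\<gamma> \<in> \<Gamma>" for \<gamma>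
    using cont that by (simp add: unit_cube_def continuous_map_componentwise)
  have contk: "continuous_map X (unit_cube ?\<Delta>) ?k"
    unfolding unit_cube_def continuous_map_componentwise
    using coord by auto
  have injk: "inj_on ?k (topspace X)"
  proof (rule inj_onI)
    fix x y assume xy: "x \<in> topspace X" "y \<in> topspace X" and eq: "?k x = ?k y"
    have "h x \<gamma> = h y \<gamma>" if "\<gamma> \<in> \<Gamma>" for \<gamma>
    proof -
      have "(\<lambda>x. h x \<gamma>) \<in> ?\<Delta>" using that by blast
      then show ?thesis using fun_cong[OF eq, of "\<lambda>x. h x \<gamma>"] by simp
    qed
    then have "h x = h y"
      using hx[OF xy(1)] hx[OF xy(2)] by (intro PiE_ext) auto
    then show "x = y" using inj xy by (simp add: inj_on_def)
  qed
  show "embedding_map X (unit_cube ?\<Delta>) ?k"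
    by (rule continuous_imp_embedding_map[OF contk X Hausdorff_space_unit_cube injk])
  show "?k x \<in> c_0 ?\<Delta>" if x: "x \<in> topspace X" and c: "h x \<in> c_0 \<Gamma>" for x
    unfolding c_0_def
  proof (intro CollectI conjI allI impI)
    show "?k x \<in> ?\<Delta> \<rightarrow>\<^sub>E {0..1}"
      using hx[OF x] by auto
    fix \<epsilon> :: real assume "\<epsilon> > 0"
    then have "finite {\<gamma> \<in> \<Gamma>. h x \<gamma> > \<epsilon>}" using c by (simp add: c_0_def)
    moreover have "{f \<in> ?\<Delta>. ?k x f > \<epsilon>} \<subseteq> (\<lambda>\<gamma> x. h x \<gamma>) ` {\<gamma> \<in> \<Gamma>. h x \<gamma> > \<epsilon>}"
      by auto
    ultimately show "finite {f \<in> ?\<Delta>. ?k x f > \<epsilon>}"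
      by (meson finite_imageI finite_subset)
  qed
qed

lemma eberlein_compactI:
  fixes X :: "'a topology" and \<Gamma> :: "'g set"
  assumes X: "compact_space X" "Hausdorff_space X"
    and C: "C \<subseteq> c_0 \<Gamma>" "X homeomorphic_space subtopology (unit_cube \<Gamma>) C"
  shows "eberlein_compact X"
proof -
  obtain h where hom: "homeomorphic_map X (subtopology (unit_cube \<Gamma>) C) h"
    using C(2) homeomorphic_space by blast
  have "C \<subseteq> topspace (unit_cube \<Gamma>)" using C(1) by (auto simp: c_0_def)
  then have im: "h ` topspace X = C"
    using homeomorphic_imp_surjective_map[OF hom] by (simp add: inf.absorb2)
  then have "embedding_map X (unit_cube \<Gamma>) h"
    using hom by (simp add: embedding_map_def)
  then obtain \<Delta> :: "('a \<Rightarrow> real) set" and k where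
    k: "embedding_map X (unit_cube \<Delta>) k"
       "\<And>x. x \<in> topspace X \<Longrightarrow> h x \<in> c_0 \<Gamma> \<Longrightarrow> k x \<in> c_0 \<Delta>"
    using unit_cube_reindex[OF X(1)] by blast
  have sub: "k ` topspace X \<subseteq> c_0 \<Delta>" using k(2) im C(1) by blast
  have homk: "homeomorphic_map X (subtopology (unit_cube \<Delta>) (k ` topspace X)) k"
    using k(1) by (simp add: embedding_map_def)
  then have "continuous_map X (unit_cube \<Delta>) k"
    using homeomorphic_imp_continuous_map continuous_map_in_subtopology by blast
  then have "compactin (unit_cube \<Delta>) (k ` topspace X)"
    using X(1) image_compactin compact_space_def by blast
  then show ?thesis
    unfolding eberlein_compact_def
    using X sub homeomorphic_map_imp_homeomorphic_space[OF homk] by blast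
qed

lemma semi_eberlein_compactI:
  fixes X :: "'a topology" and \<Gamma> :: "'g set"
  assumes X: "compact_space X" "Hausdorff_space X"
    and h: "embedding_map X (unit_cube \<Gamma>) h"
    and dense: "subtopology (unit_cube \<Gamma>) (h ` topspace X) closure_of
                  (c_0 \<Gamma> \<inter> h ` topspace X) = h ` topspace X"
  shows "semi_eberlein_compact X"
proof -
  obtain \<Delta> :: "('a \<Rightarrow> real) set" and k where
    k: "embedding_map X (unit_cube \<Delta>) k"
       "\<And>x. x \<in> topspace X \<Longrightarrow> h x \<in> c_0 \<Gamma> \<Longrightarrow> k x \<in> c_0 \<Delta>"
    using unit_cube_reindex[OF X(1) h] by blast
  define D where "D = {x \<in> topspace X. h x \<in> c_0 \<Gamma>}"
  have hom: "homeomorphic_map X (subtopology (unit_cube \<Gamma>) (h ` topspace X)) h"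
    using h by (simp add: embedding_map_def)
  have homk: "homeomorphic_map X (subtopology (unit_cube \<Delta>) (k ` topspace X)) k"
    using k(1) by (simp add: embedding_map_def)
  have D: "D \<subseteq> topspace X" by (auto simp: D_def)
  have "c_0 \<Gamma> \<inter> h ` topspace X = h ` D" by (auto simp: D_def)
  then have "h ` (X closure_of D) = h ` topspace X"
    using homeomorphic_map_closure_of[OF hom D] dense by simp
  moreover have "inj_on h (topspace X)"
    using hom by (simp add: homeomorphic_eq_everything_map)
  ultimately have "X closure_of D = topspace X"
    by (meson closure_of_subset_topspace inj_on_image_eq_iff order_refl)
  then have "subtopology (unit_cube \<Delta>) (k ` topspace X) closure_of (k ` D) = k ` topspace X"
    using homeomorphic_map_closure_of[OF homk D] by simp
  moreover have "k ` D \<subseteq> c_0 \<Delta> \<inter> k ` topspace X" using k(2) by (auto simp: D_def)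
  ultimately have "k ` topspace X \<subseteq> subtopology (unit_cube \<Delta>) (k ` topspace X) closure_of
                    (c_0 \<Delta> \<inter> k ` topspace X)"
    by (metis closure_of_mono)
  then have "subtopology (unit_cube \<Delta>) (k ` topspace X) closure_of
                    (c_0 \<Delta> \<inter> k ` topspace X) = k ` topspace X"
    by (intro antisym closure_of_subset_subtopology)
  then show ?thesis
    unfolding semi_eberlein_compact_def using X k(1) by blast
qed

end

theory Submission
  imports Defs
begin

text \<open>
  The implications (i) to (ii) to (iii) are easy. Given \<open>K\<close> inside \<open>c_0 \<Gamma>\<close>, adjoin to
  the coordinates one new coordinate for each \<open>y \<in> K\<close>, the indicator function of the
  isolated point \<open>(y, True)\<close>. At each point at most one new coordinate is nonzero, so the
  duplicate embeds into \<open>c_0\<close> (\<open>eberlein_compact_alexandroff_duplicate\<close>); and an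
  Eberlein compact space is semi-Eberlein with the whole image as dense set.

  For (iii) to (i), let \<open>h\<close> embed the duplicate into a cube so that the preimage of \<open>c_0\<close>
  is dense. A dense set contains every isolated point, so \<open>b x = h (x, True)\<close> lies in
  \<open>c_0\<close> for all \<open>x\<close>, while nothing of the kind is known about
  \<open>a x = h (x, False)\<close>. But \<open>a\<close> is close to \<open>b\<close>: for each single coordinate \<open>\<gamma>\<close>, only
  finitely many \<open>x\<close> have \<open>\<bar>a x \<gamma> - b x \<gamma>\<bar> \<ge> \<epsilon>\<close>, by compactness
  (\<open>finite_vertical_oscillation\<close>). Hence, for fixed \<open>r > 0\<close>, the open sets
  \<open>U \<gamma> = {x. a x \<gamma> > r}\<close> form a point-finite family once the finite sets
  \<open>F \<gamma> = {x \<in> U \<gamma>. b x \<gamma> \<le> r/2}\<close> are removed from them. In general the sets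
  \<open>U \<gamma> - F \<gamma>\<close> are not cozero sets, and they separate fewer points than the \<open>U \<gamma>\<close>.

  The way out is that only points \<open>z\<close> lying in infinitely many \<open>F \<gamma>\<close> need to be removed, and
  these are \<open>G\<^sub>\<delta>\<close> points: for infinitely many \<open>\<gamma>\<^sub>n\<close> with \<open>z \<in> F \<gamma>\<^sub>n\<close>, the open sets
  \<open>U \<gamma>\<^sub>n\<close> meet in a countable set, because a point of all \<open>U \<gamma>\<^sub>n\<close> must lie in some
  finite set \<open>F \<gamma>\<^sub>n\<close> (\<open>singleton_countable_Inter_open\<close>). So there is a peak function \<open>g z\<close>, equal to
  \<open>1\<close> exactly at \<open>z\<close>, and multiplying \<open>(a x \<gamma> - r)\<^sup>+\<close> by the factors \<open>1 - g z x\<close>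
  removes these points continuously. The functions \<open>g z\<close> themselves make up for the lost
  separation. Choosing for each such \<open>z\<close> one index \<open>j z\<close> with \<open>z \<in> F (j z)\<close> and supporting
  \<open>g z\<close> in \<open>U (j z)\<close> minus the other points of \<open>F (j z)\<close> keeps them point-finite,
  since \<open>j\<close> is finite-to-one (\<open>point_finite_refinement\<close>).

  Doing this for all rational \<open>r > 0\<close> gives countably many point-finite families of
  continuous functions which together separate the points of \<open>K\<close>. Scaling the \<open>n\<close>-th
  family by \<open>1 / (n + 1)\<close> turns them into an embedding into \<open>c_0\<close>
  (\<open>eberlein_compact_if_sigma_point_finite\<close>).
\<close>

section \<open>Families of functions that generate Eberlein compacta\<close>

lemma eberlein_compact_if_injective:
  assumes X: "compact_space X" and k: "continuous_map X (unit_cube \<Gamma>) k"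
    and inj: "inj_on k (topspace X)" and c: "k ` topspace X \<subseteq> c_0 \<Gamma>"
  shows "eberlein_compact X"
proof (rule eberlein_compactI[OF X _ c])
  show "Hausdorff_space X"
    by (rule Hausdorff_space_injective_preimage[OF Hausdorff_space_unit_cube k inj])
  have "embedding_map X (unit_cube \<Gamma>) k"
    by (rule continuous_imp_embedding_map[OF k X Hausdorff_space_unit_cube inj])
  then show "X homeomorphic_space subtopology (unit_cube \<Gamma>) (k ` topspace X)"
    unfolding embedding_map_def by (rule homeomorphic_map_imp_homeomorphic_space)
qed

text \<open>
  This is the easy half of Rosenthal's characterization of Eberlein compacta by
  \<open>\<sigma>\<close>-point-finite separating families of cozero sets. At a given point, values above
  \<open>\<epsilon>\<close> after scaling by \<open>1 / (n + 1)\<close> come only from the first few families, each of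
  which contributes finitely many.
\<close>

lemma eberlein_compact_if_sigma_point_finite:
  fixes S :: "nat \<Rightarrow> ('a \<Rightarrow> real) set"
  assumes X: "compact_space X"
    and cont: "\<And>n k. k \<in> S n \<Longrightarrow> continuous_map X (top_of_set {0..1}) k"
    and fin: "\<And>n x. x \<in> topspace X \<Longrightarrow> finite {k \<in> S n. k x > 0}"
    and sep: "\<And>x y. x \<in> topspace X \<Longrightarrow> y \<in> topspace X \<Longrightarrow> x \<noteq> y \<Longrightarrow> \<exists>n. \<exists>k\<in>S n. k x \<noteq> k y"
  shows "eberlein_compact X"
proof -
  define \<Gamma> where "\<Gamma> = (SIGMA n:UNIV. S n)"
  define \<Phi> where "\<Phi> = (\<lambda>x. \<lambda>(n, k)\<in>\<Gamma>. k x / (real n + 1))"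
  have range: "k x \<in> {0..1}" if "k \<in> S n" "x \<in> topspace X" for n k x
    using continuous_map_funspace[OF cont[OF that(1)]] that(2) by auto
  have coord: "continuous_map X (top_of_set {0..1}) (\<lambda>x. k x / (real n + 1))" if k: "k \<in> S n" for n k
    unfolding continuous_map_in_subtopology
  proof
    have "continuous_map X euclideanreal k"
      using cont[OF k] by (simp add: continuous_map_in_subtopology)
    then show "continuous_map X euclideanreal (\<lambda>x. k x / (real n + 1))"
      by (intro continuous_intros) auto
    show "(\<lambda>x. k x / (real n + 1)) \<in> topspace X \<rightarrow> {0..1}"
      using range[OF k] by (fastforce simp: divide_simps)
  qed
  have cont\<Phi>: "continuous_map X (unit_cube \<Gamma>) \<Phi>"
    unfolding unit_cube_def continuous_map_componentwise \<Phi>_def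
    using coord by (auto simp: \<Gamma>_def)
  show ?thesis
  proof (rule eberlein_compact_if_injective[OF X cont\<Phi>])
    show "inj_on \<Phi> (topspace X)"
    proof (rule inj_onI, rule ccontr)
      fix x y assume xy: "x \<in> topspace X" "y \<in> topspace X" "\<Phi> x = \<Phi> y" "x \<noteq> y"
      then obtain n k where k: "k \<in> S n" "k x \<noteq> k y" using sep by blast
      then have "\<Phi> x (n, k) \<noteq> \<Phi> y (n, k)" by (simp add: \<Phi>_def \<Gamma>_def)
      with xy(3) show False by simp
    qed
    show "\<Phi> ` topspace X \<subseteq> c_0 \<Gamma>"
    proof (rule image_subsetI)
      fix x assume x: "x \<in> topspace X"
      have "finite {\<gamma> \<in> \<Gamma>. \<Phi> x \<gamma> > \<epsilon>}" if "\<epsilon> > 0" for \<epsilon>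
      proof -
        obtain N where N: "inverse (real (Suc N)) < \<epsilon>"
          using reals_Archimedean \<open>\<epsilon> > 0\<close> by blast
        have "{\<gamma> \<in> \<Gamma>. \<Phi> x \<gamma> > \<epsilon>} \<subseteq> (SIGMA n:{..N}. {k \<in> S n. k x > 0})"
        proof
          fix \<gamma> assume \<gamma>: "\<gamma> \<in> {\<gamma> \<in> \<Gamma>. \<Phi> x \<gamma> > \<epsilon>}"
          obtain n k where nk: "\<gamma> = (n, k)" by (cases \<gamma>)
          have k: "k \<in> S n" and less: "\<epsilon> < k x / (real n + 1)"
            using \<gamma> nk by (auto simp: \<Gamma>_def \<Phi>_def)
          have "k x / (real n + 1) \<le> inverse (real (Suc n))"
            using range[OF k x] by (simp add: inverse_eq_divide add.commute divide_right_mono)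
          then have "inverse (real (Suc N)) < inverse (real (Suc n))" using N less by linarith
          then have "n \<le> N" by simp
          moreover have "0 < k x / (real n + 1)" using less \<open>\<epsilon> > 0\<close> by linarith
          then have "k x > 0" by (simp add: zero_less_divide_iff)
          ultimately show "\<gamma> \<in> (SIGMA n:{..N}. {k \<in> S n. k x > 0})" using k nk by simp
        qed
        moreover have "finite (SIGMA n:{..N}. {k \<in> S n. k x > 0})"
          using fin[OF x] by (intro finite_SigmaI) auto
        ultimately show ?thesis by (rule finite_subset)
      qed
      moreover have "\<Phi> x \<in> \<Gamma> \<rightarrow>\<^sub>E {0..1}"
        using continuous_map_funspace[OF cont\<Phi>] x by auto
      ultimately show "\<Phi> x \<in> c_0 \<Gamma>" by (auto simp: c_0_def)
    qed
  qed
qed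

section \<open>Isolating exceptional points by peak functions\<close>

text \<open>
  Urysohn functions \<open>c n\<close> that are \<open>1\<close> at \<open>x\<close> and vanish off \<open>G n \<inter> W\<close> are averaged with
  the weights \<open>(1/2) ^ Suc n\<close>. As the weights add up to \<open>1\<close>, the average is \<open>1\<close> only where
  every \<open>c n\<close> is \<open>1\<close>, hence only in the intersection of the \<open>G n\<close>.
\<close>

lemma peak_function:
  fixes G :: "nat \<Rightarrow> 'a set"
  assumes K: "normal_space K" "t1_space K" and G: "\<And>n. openin K (G n)" "(\<Inter>n. G n) = {x}"
    and W: "openin K W" "x \<in> W"
  obtains g where "continuous_map K (top_of_set {0..1::real}) g" "g x = 1"
    "\<And>y. y \<in> topspace K \<Longrightarrow> y \<notin> W \<Longrightarrow> g y = 0"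
    "\<And>y. y \<in> topspace K \<Longrightarrow> g y = 1 \<Longrightarrow> y = x"
proof -
  have xK: "x \<in> topspace K" using W openin_subset by blast
  have "\<exists>f. continuous_map K (top_of_set {0..1::real}) f \<and> f ` (topspace K - G n \<inter> W) \<subseteq> {0}
      \<and> f ` {x} \<subseteq> {1}" for n
  proof -
    have "closedin K (topspace K - G n \<inter> W)" using G(1) W(1) by blast
    moreover have "closedin K {x}" by (rule closedin_t1_singleton[OF K(2) xK])
    moreover have "disjnt (topspace K - G n \<inter> W) {x}" using G(2) W(2) by auto
    ultimately show ?thesis using K(1) unfolding normal_space_iff_Urysohn by blast
  qed
  then obtain c where cont: "\<And>n. continuous_map K (top_of_set {0..1::real}) (c n)"
    and c0: "\<And>n y. y \<in> topspace K \<Longrightarrow> y \<notin> G n \<inter> W \<Longrightarrow> c n y = 0" and c1: "\<And>n. c n x = 1"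
    by (metis (no_types, lifting) Diff_iff image_subset_iff insertI1 singletonD)
  have range: "0 \<le> c n y" "c n y \<le> 1" if "y \<in> topspace K" for n y
    using continuous_map_funspace[OF cont[of n]] that by auto
  have contr: "continuous_map K euclideanreal (c n)" for n
    using cont[of n] by (simp add: continuous_map_in_subtopology)
  define t where "t = (\<lambda>n y. (1/2)^Suc n * c n y)"
  define g where "g = (\<lambda>y. \<Sum>n. t n y)"
  have half: "(\<lambda>n. (1/2)^Suc n) sums (1::real)" by (rule power_half_series)
  have t: "0 \<le> t n y" "t n y \<le> (1/2)^Suc n" if "y \<in> topspace K" for n y
    using range[OF that] by (auto simp: t_def)
  have sum_t: "summable (\<lambda>n. t n y)" if "y \<in> topspace K" for y
    by (rule summable_comparison_test'[OF sums_summable[OF half], of 0])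
       (use t[OF that] in auto)
  have unif: "uniform_limit (topspace K) (\<lambda>n y. \<Sum>i<n. t i y) g sequentially"
    unfolding g_def
    by (rule Weierstrass_m_test[OF _ sums_summable[OF half]]) (use t in auto)
  have "continuous_map K Met_TC.mtopology g"
  proof (rule Met_TC.continuous_map_uniform_limit)
    show "\<forall>\<^sub>F n in sequentially. continuous_map K Met_TC.mtopology (\<lambda>y. \<Sum>i<n. t i y)"
      unfolding t_def by (auto intro!: always_eventually continuous_intros contr)
    show "\<forall>\<^sub>F n in sequentially. \<forall>y\<in>topspace K. g y \<in> UNIV \<and> dist (\<Sum>i<n. t i y) (g y) < \<epsilon>"
      if "0 < \<epsilon>" for \<epsilon>
      using uniform_limitD[OF unif that] by simp
  qed simp
  then have contg: "continuous_map K euclideanreal g" by simp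
  have g0: "0 \<le> g y" if "y \<in> topspace K" for y
    unfolding g_def by (rule suminf_nonneg[OF sum_t]) (use t that in auto)
  have g1: "g y \<le> 1" if "y \<in> topspace K" for y
    using suminf_le[OF t(2)[OF that] sum_t[OF that] sums_summable[OF half]] sums_unique[OF half]
    by (simp add: g_def)
  show thesis
  proof
    show "continuous_map K (top_of_set {0..1}) g"
      unfolding continuous_map_in_subtopology using contg g0 g1 by auto
    show "g x = 1"
      using sums_unique[OF half] by (simp add: g_def t_def c1)
    show "g y = 0" if "y \<in> topspace K" "y \<notin> W" for y
      using c0 that by (simp add: g_def t_def)
    show "y = x" if y: "y \<in> topspace K" and gy: "g y = 1" for y
    proof -
      have "(\<lambda>n. (1/2)^Suc n - t n y) sums (1 - g y)"
        unfolding g_def by (intro sums_diff half summable_sums sum_t[OF y])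
      then have "(1/2)^Suc n - t n y = 0" for n
        using suminf_eq_zero_iff[of "\<lambda>n. (1/2)^Suc n - t n y"] t(2)[OF y] gy
        by (simp add: sums_iff)
      then have "c n y \<noteq> 0" for n by (auto simp: t_def)
      then have "y \<in> (\<Inter>n. G n)" using c0[OF y] by blast
      then show "y = x" using G(2) by simp
    qed
  qed
qed

text \<open>
  Take countably many indices and delete from each \<open>U i\<close> the finitely many points of
  \<open>F i\<close> other than \<open>x\<close>. A second point in the intersection would lie in infinitely many
  sets \<open>U i - F i\<close>.
\<close>

lemma singleton_countable_Inter_open:
  assumes K: "t1_space K" and A: "infinite A"
    and U: "\<And>i. i \<in> A \<Longrightarrow> openin K (U i)"
    and F: "\<And>i. i \<in> A \<Longrightarrow> finite (F i)" "\<And>i. i \<in> A \<Longrightarrow> F i \<subseteq> topspace K"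
    and x: "\<And>i. i \<in> A \<Longrightarrow> x \<in> U i"
    and fin: "\<And>y. y \<in> topspace K \<Longrightarrow> finite {i \<in> A. y \<in> U i - F i}"
  obtains G :: "nat \<Rightarrow> 'a set" where "\<And>n. openin K (G n)" "(\<Inter>n. G n) = {x}"
proof -
  obtain e :: "nat \<Rightarrow> 'b" where e: "inj e" "range e \<subseteq> A"
    using infinite_countable_subset[OF A] by blast
  then have eA: "e n \<in> A" for n by blast
  let ?O = "\<lambda>n. U (e n) - (F (e n) - {x})"
  show thesis
  proof
    show "openin K (?O n)" for n
    proof (rule openin_diff[OF U[OF eA]])
      show "closedin K (F (e n) - {x})"
        using K F[OF eA[of n]] unfolding t1_space_closedin_finite by (meson Diff_subset finite_Diff subset_trans)
    qed
    have "y = x" if y: "\<And>n. y \<in> ?O n" for y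
    proof (rule ccontr)
      assume "y \<noteq> x"
      then have "range e \<subseteq> {i \<in> A. y \<in> U i - F i}" using y eA by auto
      moreover have "y \<in> topspace K" using y[of 0] openin_subset[OF U[OF eA]] by blast
      ultimately have "finite (range e)" using fin finite_subset by blast
      then show False using e(1) finite_imageD by blast
    qed
    moreover have "x \<in> ?O n" for n using x[OF eA] by simp
    ultimately show "(\<Inter>n. ?O n) = {x}" by auto
  qed
qed

text \<open>
  Passing from point-finiteness up to the finite exceptional sets \<open>F i\<close> to genuine
  point-finiteness, without losing separation. Call \<open>z\<close> bad if it lies in infinitely many
  \<open>F i\<close>; bad points are the only obstruction to point-finiteness of the supports of the
  \<open>f i\<close>. The new family consists of the \<open>f i\<close> with the bad points of \<open>F i\<close> cut out by
  factors \<open>1 - g z\<close>, together with the peak functions \<open>g z\<close> of the bad points.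
\<close>

lemma point_finite_refinement:
  fixes f :: "'i \<Rightarrow> 'a \<Rightarrow> real"
  assumes K: "normal_space K" "t1_space K"
    and f: "\<And>i. i \<in> I \<Longrightarrow> continuous_map K (top_of_set {0..1}) (f i)"
    and F: "\<And>i. i \<in> I \<Longrightarrow> finite (F i)" "\<And>i. i \<in> I \<Longrightarrow> F i \<subseteq> {x \<in> topspace K. f i x > 0}"
    and fin: "\<And>x. x \<in> topspace K \<Longrightarrow> finite {i \<in> I. f i x > 0 \<and> x \<notin> F i}"
  obtains S :: "('a \<Rightarrow> real) set"
  where "\<And>k. k \<in> S \<Longrightarrow> continuous_map K (top_of_set {0..1}) k"
    "\<And>x. x \<in> topspace K \<Longrightarrow> finite {k \<in> S. k x > 0}"
    "\<And>i x y. i \<in> I \<Longrightarrow> x \<in> topspace K \<Longrightarrow> y \<in> topspace K \<Longrightarrow> f i x > 0 \<Longrightarrow> f i y = 0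
       \<Longrightarrow> \<exists>k\<in>S. k x \<noteq> k y"
proof -
  define U where "U = (\<lambda>i. {x \<in> topspace K. f i x > 0})"
  define N where "N = (\<lambda>x. {i \<in> I. f i x > 0 \<and> x \<notin> F i})"
  have contf: "continuous_map K euclideanreal (f i)" if "i \<in> I" for i
    using f[OF that] by (simp add: continuous_map_in_subtopology)
  have rangef: "0 \<le> f i x" "f i x \<le> 1" if "i \<in> I" "x \<in> topspace K" for i x
    using continuous_map_funspace[OF f[OF that(1)]] that(2) by auto
  have U: "openin K (U i)" if "i \<in> I" for i
    using openin_continuous_map_preimage[OF contf[OF that], of "{0<..}"] by (simp add: U_def)
  \<comment> \<open>The bad points.\<close>
  define B where "B = {x \<in> topspace K. infinite {i \<in> I. x \<in> F i}}"
  define P where "P = (\<lambda>z i g. i \<in> I \<and> z \<in> F i \<and> continuous_map K (top_of_set {0..1::real}) g \<and> g z = 1 \<and>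
      (\<forall>y\<in>topspace K. y \<notin> U i - (F i - {z}) \<longrightarrow> g y = 0) \<and>
      (\<forall>y\<in>topspace K. g y = 1 \<longrightarrow> y = z))"
  have "\<exists>i g. P z i g" if z: "z \<in> B" for z
  proof -
    let ?A = "{i \<in> I. z \<in> F i}"
    have inf: "infinite ?A" using z by (simp add: B_def)
    then obtain i where i: "i \<in> I" "z \<in> F i" by (metis (mono_tags, lifting) Collect_empty_eq finite.emptyI)
    have zU: "z \<in> U j" if "j \<in> ?A" for j using F(2) that by (auto simp: U_def)
    obtain G :: "nat \<Rightarrow> 'a set" where G: "\<And>n. openin K (G n)" "(\<Inter>n. G n) = {z}"
    proof (rule singleton_countable_Inter_open[OF K(2) inf, of U F z])
      fix y assume "y \<in> topspace K"
      then show "finite {i \<in> ?A. y \<in> U i - F i}"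
        by (rule finite_subset[OF _ fin, rotated]) (auto simp: U_def)
    qed (use U F zU in \<open>auto simp: subset_iff\<close>)
    have W: "openin K (U i - (F i - {z}))"
    proof (rule openin_diff[OF U[OF i(1)]])
      show "closedin K (F i - {z})"
        using K(2) F[OF i(1)] unfolding t1_space_closedin_finite by (simp add: subset_iff)
    qed
    have "z \<in> U i - (F i - {z})" using zU i by simp
    from peak_function[OF K G W this] obtain g where "continuous_map K (top_of_set {0..1::real}) g" "g z = 1"
      "\<And>y. y \<in> topspace K \<Longrightarrow> y \<notin> U i - (F i - {z}) \<Longrightarrow> g y = 0"
      "\<And>y. y \<in> topspace K \<Longrightarrow> g y = 1 \<Longrightarrow> y = z"
      by blast
    then have "P z i g" unfolding P_def using i by blast
    then show ?thesis by blast
  qed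
  then obtain j g where P: "\<And>z. z \<in> B \<Longrightarrow> P z (j z) (g z)" by metis
  have j: "\<And>z. z \<in> B \<Longrightarrow> j z \<in> I" "\<And>z. z \<in> B \<Longrightarrow> z \<in> F (j z)"
    and contg: "\<And>z. z \<in> B \<Longrightarrow> continuous_map K (top_of_set {0..1::real}) (g z)"
    and gz: "\<And>z. z \<in> B \<Longrightarrow> g z z = 1"
    and g0: "\<And>z y. z \<in> B \<Longrightarrow> y \<in> topspace K \<Longrightarrow> y \<notin> U (j z) - (F (j z) - {z}) \<Longrightarrow> g z y = 0"
    and g1: "\<And>z y. z \<in> B \<Longrightarrow> y \<in> topspace K \<Longrightarrow> g z y = 1 \<Longrightarrow> y = z"
    using P unfolding P_def by blast+
  have contgr: "continuous_map K euclideanreal (g z)" if "z \<in> B" for z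
    using contg[OF that] by (simp add: continuous_map_in_subtopology)
  have rangeg: "0 \<le> g z x" "g z x \<le> 1" if "z \<in> B" "x \<in> topspace K" for z x
    using continuous_map_funspace[OF contg[OF that(1)]] that(2) by auto
  define \<phi> where "\<phi> = (\<lambda>i x. f i x * (\<Prod>z\<in>F i \<inter> B. 1 - g z x))"
  have prod01: "0 \<le> (\<Prod>z\<in>F i \<inter> B. 1 - g z x)" "(\<Prod>z\<in>F i \<inter> B. 1 - g z x) \<le> 1"
    if "x \<in> topspace K" for i x
    using rangeg that by (auto intro!: prod_nonneg prod_le_1)
  have pos_f: "f i x > 0" "x \<in> F i \<Longrightarrow> x \<notin> B" if "i \<in> I" "x \<in> topspace K" "\<phi> i x > 0" for i x
  proof -
    show "f i x > 0"
      using that(3) prod01(1)[OF that(2), of i] by (simp add: \<phi>_def zero_less_mult_iff)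
    show "x \<notin> B" if "x \<in> F i"
    proof
      assume "x \<in> B"
      then have "(\<Prod>z\<in>F i \<inter> B. 1 - g z x) = 0"
        using F(1)[OF \<open>i \<in> I\<close>] that gz[of x] by (intro prod_zero) auto
      then show False using \<open>\<phi> i x > 0\<close> by (simp add: \<phi>_def)
    qed
  qed
  show thesis
  proof (rule that[of "g ` B \<union> \<phi> ` I"])
    fix k assume "k \<in> g ` B \<union> \<phi> ` I"
    moreover have "continuous_map K (top_of_set {0..1}) (\<phi> i)" if i: "i \<in> I" for i
      unfolding continuous_map_in_subtopology
    proof
      show "continuous_map K euclideanreal (\<phi> i)"
        unfolding \<phi>_def using F(1)[OF i] contgr contf[OF i] by (intro continuous_intros) auto
      show "\<phi> i \<in> topspace K \<rightarrow> {0..1}"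
        using prod01 rangef[OF i] by (auto simp: \<phi>_def intro!: mult_le_one)
    qed
    ultimately show "continuous_map K (top_of_set {0..1}) k" using contg by blast
  next
    fix x assume x: "x \<in> topspace K"
    have N: "finite (N x)" using fin[OF x] by (simp add: N_def)
    \<comment> \<open>If \<open>g z x > 0\<close> and \<open>z \<noteq> x\<close> then \<open>j z\<close> is one of the finitely many indices in
      \<open>N x\<close>, and each index \<open>i\<close> is \<open>j z\<close> only for points \<open>z\<close> of the finite set \<open>F i\<close>.\<close>
    have "{z \<in> B. g z x > 0} \<subseteq> {x} \<union> (\<Union>i\<in>N x. F i)"
    proof
      fix z assume "z \<in> {z \<in> B. g z x > 0}"
      then have z: "z \<in> B" and "g z x \<noteq> 0" by auto
      then have "x \<in> U (j z) - (F (j z) - {z})" using g0 x by blast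
      then show "z \<in> {x} \<union> (\<Union>i\<in>N x. F i)" using j[OF z] by (auto simp: N_def U_def)
    qed
    moreover have "finite ({x} \<union> (\<Union>i\<in>N x. F i))" using N F(1) by (auto simp: N_def)
    ultimately have fing: "finite {z \<in> B. g z x > 0}" by (rule finite_subset)
    have "{i \<in> I. \<phi> i x > 0} \<subseteq> N x \<union> (if x \<in> B then {} else {i \<in> I. x \<in> F i})"
      using pos_f x by (auto simp: N_def)
    moreover have "finite (N x \<union> (if x \<in> B then {} else {i \<in> I. x \<in> F i}))"
      using N x by (auto simp: B_def)
    ultimately have fin\<phi>: "finite {i \<in> I. \<phi> i x > 0}" by (rule finite_subset)
    have "{k \<in> g ` B \<union> \<phi> ` I. k x > 0} \<subseteq> g ` {z \<in> B. g z x > 0} \<union> \<phi> ` {i \<in> I. \<phi> i x > 0}"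
      by blast
    then show "finite {k \<in> g ` B \<union> \<phi> ` I. k x > 0}"
      using fing fin\<phi> by (meson finite_UnI finite_imageI finite_subset)
  next
    fix i x y assume i: "i \<in> I" and x: "x \<in> topspace K" and y: "y \<in> topspace K"
      and fx: "f i x > 0" and fy: "f i y = 0"
    show "\<exists>k\<in>g ` B \<union> \<phi> ` I. k x \<noteq> k y"
    proof (cases "x \<in> B")
      case True
      have "x \<noteq> y" using fx fy by auto
      then have "g x x \<noteq> g x y" using gz[OF True] g1[OF True y] by auto
      then show ?thesis using True by blast
    next
      case False
      have "1 - g z x > 0" if "z \<in> F i \<inter> B" for z
        using rangeg(2)[of z x] g1[of z x] that x False by force
      then have "\<phi> i x > 0" using fx by (auto simp: \<phi>_def intro!: mult_pos_pos prod_pos)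
      moreover have "\<phi> i y = 0" using fy by (simp add: \<phi>_def)
      ultimately have "\<phi> i x \<noteq> \<phi> i y" by simp
      then show ?thesis using i by blast
    qed
  qed
qed

section \<open>The Alexandroff duplicate\<close>

text \<open>
  Near \<open>(x, False)\<close> the function is almost constant on both levels, except possibly at
  \<open>(x, True)\<close>. So \<open>x\<close> has a neighbourhood in which no other point oscillates by \<open>e\<close>, and
  the centres of a finite subcover are the only candidates.
\<close>

lemma finite_vertical_oscillation:
  fixes f :: "'a \<times> bool \<Rightarrow> real"
  assumes K: "compact_space K" and f: "continuous_map (alexandroff_duplicate K) euclideanreal f"
    and e: "e > 0"
  shows "finite {x \<in> topspace K. \<bar>f (x, False) - f (x, True)\<bar> \<ge> e}"
proof -
  have "\<exists>U. openin K U \<and> x \<in> U \<and> (\<forall>y\<in>U. y \<noteq> x \<longrightarrow> \<bar>f (y, False) - f (y, True)\<bar> < e)"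
    if x: "x \<in> topspace K" for x
  proof -
    let ?W = "{p \<in> topspace (alexandroff_duplicate K). f p \<in> ball (f (x, False)) (e/2)}"
    have "openin (alexandroff_duplicate K) ?W"
      by (rule openin_continuous_map_preimage[OF f]) simp
    moreover have "(x, False) \<in> ?W" using x e by simp
    ultimately obtain U where U: "openin K U" "x \<in> U" "U \<times> UNIV - {(x, True)} \<subseteq> ?W"
      unfolding openin_alexandroff_duplicate by blast
    have "\<bar>f (y, False) - f (y, True)\<bar> < e" if y: "y \<in> U" "y \<noteq> x" for y
    proof -
      have "(y, False) \<in> ?W" "(y, True) \<in> ?W" using U(3) y by blast+
      then have "\<bar>f (x, False) - f (y, False)\<bar> < e/2" "\<bar>f (x, False) - f (y, True)\<bar> < e/2"
        by (simp_all add: dist_real_def)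
      then show ?thesis by linarith
    qed
    then show ?thesis using U by blast
  qed
  then obtain U where U: "\<And>x. x \<in> topspace K \<Longrightarrow> openin K (U x)"
      "\<And>x. x \<in> topspace K \<Longrightarrow> x \<in> U x"
      "\<And>x y. x \<in> topspace K \<Longrightarrow> y \<in> U x \<Longrightarrow> y \<noteq> x \<Longrightarrow> \<bar>f (y, False) - f (y, True)\<bar> < e"
    by metis
  have "\<exists>\<F>. finite \<F> \<and> \<F> \<subseteq> U ` topspace K \<and> topspace K \<subseteq> \<Union>\<F>"
    using K U(1,2) unfolding compact_space_def by (intro compactinD) auto
  then obtain T where T: "T \<subseteq> topspace K" "finite T" "topspace K \<subseteq> (\<Union>x\<in>T. U x)"
    by (metis finite_subset_image)
  have "{x \<in> topspace K. \<bar>f (x, False) - f (x, True)\<bar> \<ge> e} \<subseteq> T"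
  proof clarify
    fix y assume y: "y \<in> topspace K" and ge: "e \<le> \<bar>f (y, False) - f (y, True)\<bar>"
    obtain x where "x \<in> T" "y \<in> U x" using T(3) y by blast
    then show "y \<in> T" using U(3)[of x y] T(1) ge by fastforce
  qed
  then show ?thesis using T(2) finite_subset by blast
qed

text \<open>
  Finitely many members of the cover contain the whole duplicate except for finitely many
  isolated points \<open>(x, True)\<close>, one for each centre of a finite subcover of \<open>K\<close>.
\<close>

lemma compact_space_alexandroff_duplicate:
  assumes K: "compact_space K"
  shows "compact_space (alexandroff_duplicate K)"
  unfolding compact_space_alt
proof (intro allI impI, elim conjE)
  fix \<U> assume op: "\<forall>W\<in>\<U>. openin (alexandroff_duplicate K) W"
    and cov: "topspace (alexandroff_duplicate K) \<subseteq> \<Union>\<U>"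
  have "\<exists>W\<in>\<U>. p \<in> W" if "p \<in> topspace K \<times> UNIV" for p using cov that by auto
  then obtain W where W: "\<And>p. p \<in> topspace K \<times> UNIV \<Longrightarrow> W p \<in> \<U> \<and> p \<in> W p" by metis
  have "\<exists>U. openin K U \<and> x \<in> U \<and> U \<times> UNIV - {(x, True)} \<subseteq> W (x, False)"
    if "x \<in> topspace K" for x
  proof -
    have "W (x, False) \<in> \<U>" "(x, False) \<in> W (x, False)" using W that by auto
    then show ?thesis using op unfolding openin_alexandroff_duplicate by blast
  qed
  then obtain U where U: "\<And>x. x \<in> topspace K \<Longrightarrow> openin K (U x)"
      "\<And>x. x \<in> topspace K \<Longrightarrow> x \<in> U x"
      "\<And>x. x \<in> topspace K \<Longrightarrow> U x \<times> UNIV - {(x, True)} \<subseteq> W (x, False)"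
    by metis
  have "\<exists>\<F>. finite \<F> \<and> \<F> \<subseteq> U ` topspace K \<and> topspace K \<subseteq> \<Union>\<F>"
    using K U(1,2) unfolding compact_space_def by (intro compactinD) auto
  then obtain T where T: "T \<subseteq> topspace K" "finite T" "topspace K \<subseteq> (\<Union>x\<in>T. U x)"
    by (metis finite_subset_image)
  have "topspace K \<times> UNIV \<subseteq> \<Union>(W ` (T \<times> UNIV))"
  proof
    fix p :: "'a \<times> bool" assume p: "p \<in> topspace K \<times> UNIV"
    then obtain x where x: "x \<in> T" "fst p \<in> U x" using T(3) by fastforce
    show "p \<in> \<Union>(W ` (T \<times> UNIV))"
    proof (cases "p = (x, True)")
      case True
      then show ?thesis using W[OF p] x(1) by blast
    next
      case False
      then have "p \<in> U x \<times> UNIV - {(x, True)}" using x(2) by (cases p) auto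
      then have "p \<in> W (x, False)" using U(3) x(1) T(1) by blast
      then show ?thesis using x(1) by blast
    qed
  qed
  moreover have "W ` (T \<times> UNIV) \<subseteq> \<U>" using W T(1) by auto
  moreover have "finite (W ` (T \<times> UNIV))" using T(2) by simp
  ultimately show "\<exists>\<F>. finite \<F> \<and> \<F> \<subseteq> \<U> \<and> topspace (alexandroff_duplicate K) \<subseteq> \<Union>\<F>"
    by (metis topspace_alexandroff_duplicate)
qed

lemma continuous_map_alexandroff_duplicate_fst:
  "continuous_map (alexandroff_duplicate K) K fst"
  unfolding continuous_map_def
proof (intro conjI allI impI)
  fix U assume "openin K U"
  then show "openin (alexandroff_duplicate K) {p \<in> topspace (alexandroff_duplicate K). fst p \<in> U}"
    unfolding openin_alexandroff_duplicate using openin_subset[of K U]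
    by (intro conjI allI impI exI[of _ U]) auto
qed auto

lemma continuous_map_alexandroff_duplicate_isolated:
  assumes K: "t1_space K"
  shows "continuous_map (alexandroff_duplicate K) (top_of_set {0..1}) (\<lambda>p. of_bool (p = (y, True)) :: real)"
  unfolding continuous_map_def openin_alexandroff_duplicate
proof (intro conjI allI impI)
  fix V and x assume "(x, False) \<in> {p \<in> topspace (alexandroff_duplicate K). of_bool (p = (y, True)) \<in> V}"
  then have x: "x \<in> topspace K" and V: "0 \<in> V" by auto
  let ?U = "if x = y then topspace K else topspace K - {y}"
  have "openin K ?U" using K by (simp add: t1_space_openin_delete_alt)
  moreover have "x \<in> ?U" using x by auto
  moreover have "?U \<times> UNIV - {(x, True)} \<subseteq> {p \<in> topspace (alexandroff_duplicate K). of_bool (p = (y, True)) \<in> V}"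
    using V by auto
  ultimately show "\<exists>U. openin K U \<and> x \<in> U \<and>
      U \<times> UNIV - {(x, True)} \<subseteq> {p \<in> topspace (alexandroff_duplicate K). of_bool (p = (y, True)) \<in> V}"
    by blast
qed auto

lemma eberlein_compact_alexandroff_duplicate:
  fixes K :: "'a topology"
  assumes "eberlein_compact K"
  shows "eberlein_compact (alexandroff_duplicate K)"
proof -
  let ?D = "alexandroff_duplicate K"
  obtain \<Gamma> :: "('a \<Rightarrow> real) set" and C where K: "compact_space K" "Hausdorff_space K"
    and C: "C \<subseteq> c_0 \<Gamma>" "K homeomorphic_space subtopology (unit_cube \<Gamma>) C"
    using assms unfolding eberlein_compact_def by blast
  obtain h where hom: "homeomorphic_map K (subtopology (unit_cube \<Gamma>) C) h"
    using C(2) homeomorphic_space by blast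
  have cont: "continuous_map K (unit_cube \<Gamma>) h"
    using hom homeomorphic_imp_continuous_map continuous_map_in_subtopology by blast
  have inj: "inj_on h (topspace K)"
    using hom by (simp add: homeomorphic_eq_everything_map)
  have hc: "h x \<in> c_0 \<Gamma>" if "x \<in> topspace K" for x
    using homeomorphic_imp_surjective_map[OF hom] C(1) that by auto
  have coord: "continuous_map ?D (top_of_set {0..1}) (\<lambda>p. h (fst p) \<gamma>)" if "\<gamma> \<in> \<Gamma>" for \<gamma>
  proof -
    have "continuous_map K (top_of_set {0..1}) (\<lambda>x. h x \<gamma>)"
      using cont that by (simp add: unit_cube_def continuous_map_componentwise)
    then show ?thesis
      using continuous_map_compose[OF continuous_map_alexandroff_duplicate_fst] by (force simp: o_def)
  qed
  let ?\<Delta> = "\<Gamma> <+> topspace K"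
  define k where "k = (\<lambda>p. \<lambda>\<delta>\<in>?\<Delta>. case \<delta> of Inl \<gamma> \<Rightarrow> h (fst p) \<gamma> | Inr y \<Rightarrow> of_bool (p = (y, True)))"
  have contk: "continuous_map ?D (unit_cube ?\<Delta>) k"
    unfolding unit_cube_def continuous_map_componentwise k_def
    using coord continuous_map_alexandroff_duplicate_isolated[OF Hausdorff_imp_t1_space[OF K(2)]]
    by auto
  show ?thesis
  proof (rule eberlein_compact_if_injective[OF compact_space_alexandroff_duplicate[OF K(1)] contk])
    show "inj_on k (topspace ?D)"
    proof (rule inj_onI)
      fix p q assume p: "p \<in> topspace ?D" and q: "q \<in> topspace ?D" and eq: "k p = k q"
      have "h (fst p) \<gamma> = h (fst q) \<gamma>" if "\<gamma> \<in> \<Gamma>" for \<gamma>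
        using fun_cong[OF eq, of "Inl \<gamma>"] that by (simp add: k_def InlI)
      moreover have "h (fst p) \<in> \<Gamma> \<rightarrow>\<^sub>E {0..1}" "h (fst q) \<in> \<Gamma> \<rightarrow>\<^sub>E {0..1}"
        using hc[of "fst p"] hc[of "fst q"] p q unfolding c_0_def mem_Times_iff topspace_alexandroff_duplicate by blast+
      ultimately have "h (fst p) = h (fst q)" by (intro PiE_ext) auto
      then have "fst p = fst q" using inj_onD[OF inj, of "fst p" "fst q"] p q by (simp add: mem_Times_iff)
      moreover have "Inr (fst p) \<in> ?\<Delta>" using p by (intro InrI) auto
      then have "(p = (fst p, True)) = (q = (fst p, True))"
        using fun_cong[OF eq, of "Inr (fst p)"] by (simp add: k_def of_bool_eq_iff)
      ultimately show "p = q" by (metis (full_types) prod.collapse)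
    qed
    show "k ` topspace ?D \<subseteq> c_0 ?\<Delta>"
    proof (rule image_subsetI)
      fix p assume p: "p \<in> topspace ?D"
      have "finite {\<delta> \<in> ?\<Delta>. k p \<delta> > \<epsilon>}" if "\<epsilon> > 0" for \<epsilon>
      proof -
        have "{\<delta> \<in> ?\<Delta>. k p \<delta> > \<epsilon>} \<subseteq> Inl ` {\<gamma> \<in> \<Gamma>. h (fst p) \<gamma> > \<epsilon>} \<union> {Inr (fst p)}"
          using that by (auto simp: k_def of_bool_def split: if_splits)
        moreover have "finite {\<gamma> \<in> \<Gamma>. h (fst p) \<gamma> > \<epsilon>}"
          using hc[of "fst p"] p that by (auto simp: c_0_def)
        ultimately show ?thesis by (meson finite.emptyI finite_UnI finite_imageI finite_insert finite_subset)
      qed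
      moreover have "k p \<in> ?\<Delta> \<rightarrow>\<^sub>E {0..1}"
        using continuous_map_funspace[OF contk] p by auto
      ultimately show "k p \<in> c_0 ?\<Delta>" by (auto simp: c_0_def)
    qed
  qed
qed

lemma eberlein_imp_semi_eberlein:
  fixes X :: "'a topology"
  assumes "eberlein_compact X"
  shows "semi_eberlein_compact X"
proof -
  obtain \<Gamma> :: "('a \<Rightarrow> real) set" and C where X: "compact_space X" "Hausdorff_space X"
    and C: "C \<subseteq> c_0 \<Gamma>" "X homeomorphic_space subtopology (unit_cube \<Gamma>) C"
    using assms unfolding eberlein_compact_def by blast
  obtain h where hom: "homeomorphic_map X (subtopology (unit_cube \<Gamma>) C) h"
    using C(2) homeomorphic_space by blast
  have sub: "C \<subseteq> topspace (unit_cube \<Gamma>)" using C(1) by (auto simp: c_0_def)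
  then have im: "h ` topspace X = C"
    using homeomorphic_imp_surjective_map[OF hom] by (simp add: inf.absorb2)
  show ?thesis
  proof (rule semi_eberlein_compactI[OF X])
    show "embedding_map X (unit_cube \<Gamma>) h" using hom im by (simp add: embedding_map_def)
    have "c_0 \<Gamma> \<inter> C = C" using C(1) by blast
    then show "subtopology (unit_cube \<Gamma>) (h ` topspace X) closure_of (c_0 \<Gamma> \<inter> h ` topspace X)
        = h ` topspace X"
      unfolding im using sub closure_of_topspace[of "subtopology (unit_cube \<Gamma>) C"]
      by (simp add: inf.absorb2)
  qed
qed

lemma openin_alexandroff_duplicate_isolated:
  assumes "x \<in> topspace K"
  shows "openin (alexandroff_duplicate K) {(x, True)}"
  using assms by (simp add: openin_alexandroff_duplicate)

text \<open>
  For each threshold \<open>r\<close> the refinement is applied to the truncations \<open>(a x \<gamma> - r)\<^sup>+\<close> of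
  the coordinates on the lower level.
\<close>

lemma eberlein_compact_if_semi_eberlein_duplicate:
  fixes K :: "'a topology"
  assumes K: "compact_space K" "Hausdorff_space K"
    and D: "semi_eberlein_compact (alexandroff_duplicate K)"
  shows "eberlein_compact K"
proof -
  let ?D = "alexandroff_duplicate K"
  obtain \<Gamma> :: "('a \<times> bool \<Rightarrow> real) set" and h where emb: "embedding_map ?D (unit_cube \<Gamma>) h"
    and dense: "subtopology (unit_cube \<Gamma>) (h ` topspace ?D) closure_of (c_0 \<Gamma> \<inter> h ` topspace ?D)
          = h ` topspace ?D"
    using D unfolding semi_eberlein_compact_def by blast
  have hom: "homeomorphic_map ?D (subtopology (unit_cube \<Gamma>) (h ` topspace ?D)) h"
    using emb by (simp add: embedding_map_def)
  have cont: "continuous_map ?D (unit_cube \<Gamma>) h"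
    using hom homeomorphic_imp_continuous_map continuous_map_in_subtopology by blast
  have inj: "inj_on h (topspace ?D)"
    using hom by (simp add: homeomorphic_eq_everything_map)
  have h01: "h p \<in> \<Gamma> \<rightarrow>\<^sub>E {0..1}" if "p \<in> topspace ?D" for p
    using continuous_map_funspace[OF cont] that by auto
  have coord: "continuous_map ?D euclideanreal (\<lambda>p. h p \<gamma>)" if "\<gamma> \<in> \<Gamma>" for \<gamma>
    using cont that by (simp add: unit_cube_def continuous_map_componentwise continuous_map_in_subtopology)
  have isolated: "h (x, True) \<in> c_0 \<Gamma>" if x: "x \<in> topspace K" for x
  proof -
    have "openin (subtopology (unit_cube \<Gamma>) (h ` topspace ?D)) (h ` {(x, True)})"
      using homeomorphic_imp_open_map[OF hom] openin_alexandroff_duplicate_isolated[OF x]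
      unfolding open_map_def by blast
    moreover have "h (x, True) \<in> subtopology (unit_cube \<Gamma>) (h ` topspace ?D) closure_of
        (c_0 \<Gamma> \<inter> h ` topspace ?D)"
      using x unfolding dense by simp
    ultimately show ?thesis unfolding in_closure_of by auto
  qed
  have base: "continuous_map K ?D (\<lambda>x. (x, False))"
    unfolding continuous_map_def
  proof (intro conjI allI impI)
    show "(\<lambda>x. (x, False)) \<in> topspace K \<rightarrow> topspace ?D" by auto
    fix W assume W: "openin ?D W"
    show "openin K {x \<in> topspace K. (x, False) \<in> W}"
      unfolding openin_subopen[of K "{x \<in> topspace K. (x, False) \<in> W}"]
    proof
      fix x assume "x \<in> {x \<in> topspace K. (x, False) \<in> W}"
      then obtain U where U: "openin K U" "x \<in> U" "U \<times> UNIV - {(x, True)} \<subseteq> W"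
        using W unfolding openin_alexandroff_duplicate by blast
      then show "\<exists>T. openin K T \<and> x \<in> T \<and> T \<subseteq> {x \<in> topspace K. (x, False) \<in> W}"
        using openin_subset[OF U(1)] by (intro exI[of _ U]) auto
    qed
  qed
  have coord0: "continuous_map K euclideanreal (\<lambda>x. h (x, False) \<gamma>)" if "\<gamma> \<in> \<Gamma>" for \<gamma>
    using continuous_map_compose[OF base coord[OF that]] by (simp add: o_def)
  have a01: "0 \<le> h (x, b) \<gamma>" "h (x, b) \<gamma> \<le> 1" if "x \<in> topspace K" "\<gamma> \<in> \<Gamma>" for x b \<gamma>
    using h01[of "(x, b)"] that by (auto simp: PiE_iff)
  have level: "\<exists>S. (\<forall>k\<in>S. continuous_map K (top_of_set {0..1::real}) k) \<and>
      (\<forall>x\<in>topspace K. finite {k \<in> S. k x > 0}) \<and>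
      (\<forall>\<gamma>\<in>\<Gamma>. \<forall>x\<in>topspace K. \<forall>y\<in>topspace K.
        h (x, False) \<gamma> > r \<longrightarrow> h (y, False) \<gamma> \<le> r \<longrightarrow> (\<exists>k\<in>S. k x \<noteq> k y))"
    if r: "r > 0" for r :: real
  proof -
    let ?f = "\<lambda>\<gamma> x. max 0 (h (x, False) \<gamma> - r)"
    \<comment> \<open>The threshold \<open>r/2\<close> serves both sides: a point of \<open>?F \<gamma>\<close> oscillates by at least
      \<open>r/2\<close>, and outside \<open>?F \<gamma>\<close> the upper level exceeds \<open>r/2\<close>, which happens for only
      finitely many \<open>\<gamma>\<close> as \<open>h (x, True)\<close> lies in \<open>c_0\<close>.\<close>
    let ?F = "\<lambda>\<gamma>. {x \<in> topspace K. h (x, False) \<gamma> > r \<and> h (x, True) \<gamma> \<le> r/2}"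
    obtain S where "\<And>k. k \<in> S \<Longrightarrow> continuous_map K (top_of_set {0..1::real}) k"
      "\<And>x. x \<in> topspace K \<Longrightarrow> finite {k \<in> S. k x > 0}"
      "\<And>\<gamma> x y. \<gamma> \<in> \<Gamma> \<Longrightarrow> x \<in> topspace K \<Longrightarrow> y \<in> topspace K \<Longrightarrow> ?f \<gamma> x > 0 \<Longrightarrow> ?f \<gamma> y = 0
       \<Longrightarrow> \<exists>k\<in>S. k x \<noteq> k y"
    proof (rule point_finite_refinement[of K \<Gamma> ?f ?F])
      show "normal_space K"
        using K by (simp add: compact_Hausdorff_or_regular_imp_normal_space)
      show "t1_space K" by (rule Hausdorff_imp_t1_space[OF K(2)])
      fix \<gamma> assume \<gamma>: "\<gamma> \<in> \<Gamma>"
      show "continuous_map K (top_of_set {0..1}) (?f \<gamma>)"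
        unfolding continuous_map_in_subtopology
      proof
        show "continuous_map K euclideanreal (?f \<gamma>)"
          using coord0[OF \<gamma>] by (intro continuous_intros) auto
        have "max 0 (h (x, False) \<gamma> - r) \<le> 1" if "x \<in> topspace K" for x
          using a01(2)[OF that \<gamma>, of False] r by simp
        then show "?f \<gamma> \<in> topspace K \<rightarrow> {0..1}" by auto
      qed
      show "?F \<gamma> \<subseteq> {x \<in> topspace K. ?f \<gamma> x > 0}" by auto
      have "?F \<gamma> \<subseteq> {x \<in> topspace K. \<bar>h (x, False) \<gamma> - h (x, True) \<gamma>\<bar> \<ge> r/2}"
        by (auto simp: abs_if)
      then show "finite (?F \<gamma>)"
        using finite_vertical_oscillation[OF K(1) coord[OF \<gamma>], of "r/2"] r finite_subset by auto
    next
      fix x assume x: "x \<in> topspace K"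
      have "finite {\<gamma> \<in> \<Gamma>. h (x, True) \<gamma> > r/2}"
        using isolated[OF x] half_gt_zero[OF r] unfolding c_0_def by blast
      then show "finite {\<gamma> \<in> \<Gamma>. ?f \<gamma> x > 0 \<and> x \<notin> ?F \<gamma>}"
        by (rule rev_finite_subset) (use x in auto)
    qed (use that in blast)
    then show ?thesis by (intro exI[of _ S]) auto
  qed
  \<comment> \<open>An enumeration of the rationals; at the nonpositive ones the empty family is used.\<close>
  define r :: "nat \<Rightarrow> real" where "r = (\<lambda>n. real_of_rat (from_nat n))"
  define P where "P = (\<lambda>n S. (\<forall>k\<in>S. continuous_map K (top_of_set {0..1::real}) k) \<and>
      (\<forall>x\<in>topspace K. finite {k \<in> S. k x > 0}) \<and>
      (r n > 0 \<longrightarrow> (\<forall>\<gamma>\<in>\<Gamma>. \<forall>x\<in>topspace K. \<forall>y\<in>topspace K.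
        h (x, False) \<gamma> > r n \<longrightarrow> h (y, False) \<gamma> \<le> r n \<longrightarrow> (\<exists>k\<in>S. k x \<noteq> k y))))"
  have "\<exists>S. P n S" for n
  proof (cases "r n > 0")
    case True
    then show ?thesis using level[of "r n"] unfolding P_def by blast
  next
    case False
    then have "P n {}" by (simp add: P_def)
    then show ?thesis ..
  qed
  then obtain S where P: "\<And>n. P n (S n)" by metis
  have S: "\<And>n k. k \<in> S n \<Longrightarrow> continuous_map K (top_of_set {0..1::real}) k"
      "\<And>n x. x \<in> topspace K \<Longrightarrow> finite {k \<in> S n. k x > 0}"
      "\<And>n \<gamma> x y. \<lbrakk>r n > 0; \<gamma> \<in> \<Gamma>; x \<in> topspace K; y \<in> topspace K;
        h (x, False) \<gamma> > r n; h (y, False) \<gamma> \<le> r n\<rbrakk> \<Longrightarrow> \<exists>k\<in>S n. k x \<noteq> k y"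
    using P unfolding P_def by blast+
  have sep: "\<exists>n. \<exists>k\<in>S n. k x \<noteq> k y"
    if x: "x \<in> topspace K" and y: "y \<in> topspace K" and \<gamma>: "\<gamma> \<in> \<Gamma>"
      and less: "h (y, False) \<gamma> < h (x, False) \<gamma>" for x y \<gamma>
  proof -
    obtain q where q: "h (y, False) \<gamma> < real_of_rat q" "real_of_rat q < h (x, False) \<gamma>"
      using of_rat_dense[OF less] by blast
    have "r (to_nat q) = real_of_rat q" by (simp add: r_def)
    then have "\<exists>k\<in>S (to_nat q). k x \<noteq> k y"
      using S(3)[of "to_nat q" \<gamma> x y] q x y \<gamma> a01(1)[OF y \<gamma>, of False] by (metis less_imp_le order_le_less_trans)
    then show ?thesis ..
  qed
  show ?thesis
  proof (rule eberlein_compact_if_sigma_point_finite[OF K(1) S(1,2)])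
    fix x y assume x: "x \<in> topspace K" and y: "y \<in> topspace K" and "x \<noteq> y"
    then have "h (x, False) \<noteq> h (y, False)" using inj by (auto simp: inj_on_def)
    then obtain \<gamma> where "\<gamma> \<in> \<Gamma>" "h (x, False) \<gamma> \<noteq> h (y, False) \<gamma>"
      using PiE_ext[OF h01[of "(x, False)"] h01[of "(y, False)"]] x y by auto
    then show "\<exists>n. \<exists>k\<in>S n. k x \<noteq> k y"
      using sep[OF x y] sep[OF y x] by (metis linorder_neqE_linordered_idom)
  qed
qed

theorem theorem4p4:
  fixes K :: "'a topology"
  assumes "compact_space K" and "Hausdorff_space K"
  shows "(eberlein_compact K \<longleftrightarrow> eberlein_compact (alexandroff_duplicate K)) \<and>
         (eberlein_compact (alexandroff_duplicate K) \<longleftrightarrow>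
          semi_eberlein_compact (alexandroff_duplicate K))"
  using eberlein_compact_alexandroff_duplicate[of K]
    eberlein_imp_semi_eberlein[of "alexandroff_duplicate K"]
    eberlein_compact_if_semi_eberlein_duplicate[OF assms]
  by blast

end
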